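(* Let $d,L\ge1$ and $n\ge0$. Let $\alpha\in\Lambda_{d,L}$, let $\mathbf{x}=(x_1,\dots,x_d)\in\Delta_{d,L}$ where $x_i=\alpha_{i-1}-\alpha_i$ for $i\in[d]$, let $u=0^{x_1}10^{x_2}1\cdots 0^{x_d}1$, and let $w\in\{+,-\}^n$. There are explicit bijections between the following sets: (A) The set $\mathrm{OCT}^w_{d,L}(\alpha,\cdot)$ of oscillating cylindric tableaux of period $(d,L)$ and type $w$ starting at $\alpha$. (B) The set $\mathcal{O}^w_{d,L}(\mathbf{x})$ of oscillating walks in $\mathcal{D}_{d,L}$ of type $w$ starting at vertex $\mathbf{x}$. (C) The set of oscillating walks in $\mathcal{E}_{d,L}$ of type $w$ starting at state $u$. (D) The set of oscillating walks in $\mathcal{N}_{d,L}$ of type $w$ starting at state $[\![u]\!]$.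
   Context: Notation: $[d]=\{1,\dots,d\}$, $\mathbb{N}$ is the set of nonnegative integers; in strings, exponents denote repetition. Cylindric shapes. A cylindric shape of period $(d,L)$ is a doubly infinite weakly decreasing integer sequence $\lambda=(\lambda_i)_{i\in\mathbb{Z}}$ with $\lambda_i=\lambda_{i+d}+L$ for all $i$. $\Lambda_{d,L}$ is the set of these. A shape $\lambda$ is obtained from $\mu$ by adding a cell (in row $i\in[d]$), equivalently $\mu$ is obtained from $\lambda$ by removing a cell, if $\lambda_i=\mu_i+1$ and $\lambda_j=\mu_j$ for all $j\in[d]\setminus\{i\}$. An oscillating cylindric tableau (of length $n$, period $(d,L)$) is a sequence $\rho^0,\rho^1,\dots,\rho^n$ of elements of $\Lambda_{d,L}$ where each shape is obtained from the previous one by adding or removing one cell. Its type is the word in $\{+,-\}^n$ whose $k$th entry is $+$ if $\rho^k$ is obtained from $\rho^{k-1}$ by adding a cell, and $-$ if by removing a cell. $\mathrm{OCT}^w_{d,L}(\alpha,\cdot)$ is the set of those of type $w$ with $\rho^0=\alpha$. Simplices. $\Delta_{d,L}=\{(x_1,\dots,x_d)\in\mathbb{N}^d: x_1+\cdots+x_d=L\}$. With $e_i$ the unit coordinate vectors and $e_{d+1}=e_1$, let $s_i=e_{i+1}-e_i$ for $i\in[d]$. $\mathcal{D}_{d,L}$ is the directed graph with vertex set $\Delta_{d,L}$ and an edge from $\mathbf{x}$ to $\mathbf{y}$ whenever $\mathbf{y}-\mathbf{x}=s_i$ for some $i\in[d]$. Exclusion process. Let $N=d+L$. $\mathcal{E}_{d,L}$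 is the directed graph whose vertices (states) are the binary strings $u_1\cdots u_N$ with exactly $d$ ones, with indices modulo $N$, and with an edge from $u$ to $v$ iff there is $r$ such that $u_{r-1}u_r=01$, $v_{r-1}v_r=10$, and $u_t=v_t$ for all $t\in\mathbb{Z}_N\setminus\{r-1,r\}$. $\mathcal{N}_{d,L}$ is the directed multigraph whose vertices are the necklaces $[\![u]\!]$, i.e. equivalence classes of states under cyclic rotation; the number of edges from $[\![u]\!]$ to $[\![v]\!]$ is the number of $\tilde v\in[\![v]\!]$ such that $\mathcal{E}_{d,L}$ has an edge from $u$ to $\tilde v$ (independent of the representative $u$). An $n$-step oscillating walk in a directed multigraph is a sequence of $n$ consecutive steps, each of which follows an edge in either the forward or the backward direction (parallel edges are distinguished). Its type is the word in $\{+,-\}^n$ whose $r$th entry is $+$ or $-$ if the $r$th step is forward or backward, respectively.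
   Formalization: In (D), the number of backward steps from [[v]] to [[u]] is taken as the number of ũ in [[u]] with an edge from ũ to v, not the number of edges from [[u]] to [[v]]; with the latter the claim fails for d=L=2, u=0011, w="-" (one walk in (C), two in (D)). *)

theory Defs
  imports Main
begin

section \<open>Cylindric shapes and oscillating walks\<close>

datatype sign = Plus | Minus

definition cyl_shapes :: "nat \<Rightarrow> nat \<Rightarrow> (int \<Rightarrow> int) set" where
  "cyl_shapes d L = {f. antimono f \<and> (\<forall>i. f i = f (i + int d) + int L)}"

definition adds_cell :: "nat \<Rightarrow> (int \<Rightarrow> int) \<Rightarrow> (int \<Rightarrow> int) \<Rightarrow> bool" where
  "adds_cell d f g \<longleftrightarrow>
     (\<exists>i\<in>{1..int d}. g i = f i + 1 \<and> (\<forall>j\<in>{1..int d} - {i}. g j = f j))"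

text \<open>
  Oscillating walks of a prescribed type in a directed graph without parallel edges, as lists of
  \<open>length w + 1\<close> vertices. The type is fixed from outside, so the vertices determine the steps,
  even at loops and where both \<open>a \<rightarrow> b\<close> and \<open>b \<rightarrow> a\<close> are edges.
\<close>

definition osc_walks :: "'a set \<Rightarrow> ('a \<Rightarrow> 'a \<Rightarrow> bool) \<Rightarrow> sign list \<Rightarrow> 'a \<Rightarrow> 'a list set" where
  "osc_walks V E w a =
     {vs. length vs = Suc (length w) \<and> set vs \<subseteq> V \<and> vs ! 0 = a \<and>
        (\<forall>k<length w. case w ! k of
             Plus \<Rightarrow> E (vs ! k) (vs ! Suc k)
           | Minus \<Rightarrow> E (vs ! Suc k) (vs ! k))}"

definition oct :: "nat \<Rightarrow> nat \<Rightarrow> sign list \<Rightarrow> (int \<Rightarrow> int) \<Rightarrow> (int \<Rightarrow> int) list set" where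
  "oct d L w \<alpha> = osc_walks (cyl_shapes d L) (adds_cell d) w \<alpha>"


section \<open>The simplex\<close>

text \<open>A point \<open>(x\<^sub>1, \<dots>, x\<^sub>d)\<close> is the list with entries \<open>x ! 0, \<dots>, x ! (d - 1)\<close>.\<close>

definition simplex :: "nat \<Rightarrow> nat \<Rightarrow> nat list set" where
  "simplex d L = {x. length x = d \<and> sum_list x = L}"

text \<open>
  Coordinate \<open>j\<close> of \<open>s\<^sub>i = e\<^sub>i\<^sub>+\<^sub>1 - e\<^sub>i\<close>, with indices in \<open>{0..<d}\<close>; for \<open>d = 1\<close> it vanishes, and the
  graph below has one loop at its only vertex.
\<close>

definition simplex_step :: "nat \<Rightarrow> nat \<Rightarrow> nat \<Rightarrow> int" where
  "simplex_step d i j = of_bool (j = Suc i mod d) - of_bool (j = i)"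

definition simplex_edge :: "nat \<Rightarrow> nat list \<Rightarrow> nat list \<Rightarrow> bool" where
  "simplex_edge d x y \<longleftrightarrow>
     (\<exists>i<d. \<forall>j<d. int (y ! j) - int (x ! j) = simplex_step d i j)"

definition simplex_walks :: "nat \<Rightarrow> nat \<Rightarrow> sign list \<Rightarrow> nat list \<Rightarrow> nat list list set" where
  "simplex_walks d L w x = osc_walks (simplex d L) (simplex_edge d) w x"


section \<open>The exclusion process\<close>

text \<open>
  A binary string \<open>u\<^sub>1 \<dots> u\<^sub>N\<close> is a boolean list (\<open>True\<close> for 1), read cyclically, with \<open>u\<^sub>p\<close> at list
  position \<open>p - 1\<close>.
\<close>

definition states :: "nat \<Rightarrow> nat \<Rightarrow> bool list set" where
  "states d L = {u. length u = d + L \<and> count_list u True = d}"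

definition exclusion_edge :: "bool list \<Rightarrow> bool list \<Rightarrow> bool" where
  "exclusion_edge u v \<longleftrightarrow> length v = length u \<and>
     (\<exists>r<length u. let q = (r + length u - 1) mod length u in
        \<not> u ! q \<and> u ! r \<and> v ! q \<and> \<not> v ! r \<and>
        (\<forall>t<length u. t \<notin> {q, r} \<longrightarrow> v ! t = u ! t))"

definition exclusion_walks :: "nat \<Rightarrow> nat \<Rightarrow> sign list \<Rightarrow> bool list \<Rightarrow> bool list list set" where
  "exclusion_walks d L w u = osc_walks (states d L) exclusion_edge w u"


section \<open>Necklaces\<close>

definition necklace :: "bool list \<Rightarrow> bool list set" where
  "necklace u = range (\<lambda>k. rotate k u)"

text \<open>
  The multiplicity from necklace \<open>A\<close> to necklace \<open>B\<close> induced by a rotation-invariant relation \<open>G\<close>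
  on states: the number of \<open>v \<in> B\<close> with \<open>G u v\<close>, for any representative \<open>u \<in> A\<close>.
\<close>

definition necklace_mult :: "(bool list \<Rightarrow> bool list \<Rightarrow> bool) \<Rightarrow> bool list set \<Rightarrow> bool list set \<Rightarrow> nat" where
  "necklace_mult G A B = (THE m. \<forall>u\<in>A. card {v \<in> B. G u v} = m)"

text \<open>
  Oscillating walks in a directed multigraph, as pairs of a vertex list and a list of labels
  that tell parallel steps apart. There are \<open>f a b\<close> forward steps and \<open>g a b\<close> backward steps that
  lead from \<open>a\<close> to \<open>b\<close>.
\<close>

definition multi_osc_walks ::
  "'a set \<Rightarrow> ('a \<Rightarrow> 'a \<Rightarrow> nat) \<Rightarrow> ('a \<Rightarrow> 'a \<Rightarrow> nat) \<Rightarrow> sign list \<Rightarrow> 'a \<Rightarrow> ('a list \<times> nat list) set" where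
  "multi_osc_walks V f g w a =
     {(vs, ks). length vs = Suc (length w) \<and> length ks = length w \<and> set vs \<subseteq> V \<and> vs ! 0 = a \<and>
        (\<forall>k<length w. case w ! k of
             Plus \<Rightarrow> ks ! k < f (vs ! k) (vs ! Suc k)
           | Minus \<Rightarrow> ks ! k < g (vs ! k) (vs ! Suc k))}"

text \<open>
  The number of edges from \<open>A\<close> to \<open>B\<close> counts the states \<open>v \<in> B\<close> with an edge \<open>u \<rightarrow> v\<close>, for a fixed
  representative \<open>u\<close> of the necklace \<open>A\<close> at which a forward step starts. Backward steps are
  counted in the same way, at the necklace where the step starts: the number of those from
  \<open>B\<close> to \<open>A\<close> is the number of states \<open>u \<in> A\<close> with an edge \<open>u \<rightarrow> v\<close>, for a fixed \<open>v \<in> B\<close>. This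
  number need not be the number of edges from \<open>A\<close> to \<open>B\<close>: by \<open>card_necklace_mult\<close> below the two
  differ exactly when there is an edge and the necklaces have different cardinalities. With
  the number of edges from \<open>A\<close> to \<open>B\<close> in its place, the correspondence between exclusion walks
  and necklace walks would be false; see \<open>necklace_mult_asym\<close>.
\<close>

definition necklace_walks ::
  "nat \<Rightarrow> nat \<Rightarrow> sign list \<Rightarrow> bool list set \<Rightarrow> (bool list set list \<times> nat list) set" where
  "necklace_walks d L w A =
     multi_osc_walks (necklace ` states d L)
       (necklace_mult exclusion_edge) (necklace_mult exclusion_edge\<inverse>\<inverse>) w A"

lemma exclusion_edge_rotate1:
  assumes "exclusion_edge u v"
  shows "exclusion_edge (rotate1 u) (rotate1 v)"
proof -
  define N where "N = length u"
  define p where "p = (\<lambda>r. (r + N - 1) mod N)"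
  from assms obtain r where len: "length v = N" and r: "r < N"
    and e: "\<not> u ! p r" "u ! r" "v ! p r" "\<not> v ! r"
    and o: "\<And>t. t < N \<Longrightarrow> t \<noteq> p r \<Longrightarrow> t \<noteq> r \<Longrightarrow> v ! t = u ! t"
    unfolding exclusion_edge_def Let_def N_def p_def by auto
  have N0: "N > 0" using r by simp
  have p_lt: "p t < N" for t using N0 by (simp add: p_def)
  have pS: "p (Suc t mod N) = t" if "t < N" for t
    using that by (cases "Suc t = N") (auto simp: p_def)
  have Sp: "Suc (p t) mod N = t" if "t < N" for t
    using that by (cases t) (auto simp: p_def)
  have nth: "rotate1 u ! t = u ! (Suc t mod N)" "rotate1 v ! t = v ! (Suc t mod N)"
    if "t < N" for t
    using that len by (simp_all add: N_def nth_rotate1)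
  have o': "rotate1 v ! t = rotate1 u ! t" if "t < N" "t \<noteq> p (p r)" "t \<noteq> p r" for t
  proof -
    have "Suc t mod N \<noteq> p r" "Suc t mod N \<noteq> r"
      using that pS[of t] by auto
    then show ?thesis using o[of "Suc t mod N"] that N0 by (simp add: nth)
  qed
  have "\<not> rotate1 u ! p (p r)" "rotate1 u ! p r"
    "rotate1 v ! p (p r)" "\<not> rotate1 v ! p r"
    using e p_lt r by (simp_all add: nth Sp)
  then have "\<exists>r<N. \<not> rotate1 u ! p r \<and> rotate1 u ! r \<and> rotate1 v ! p r \<and> \<not> rotate1 v ! r \<and>
      (\<forall>t<N. t \<notin> {p r, r} \<longrightarrow> rotate1 v ! t = rotate1 u ! t)"
    using o' p_lt[of r] by blast
  then show ?thesis
    unfolding exclusion_edge_def Let_def length_rotate1 len N_def[symmetric] p_def by simp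
qed

lemma exclusion_edge_rotate:
  "exclusion_edge u v \<Longrightarrow> exclusion_edge (rotate k u) (rotate k v)"
  by (induction k) (auto intro: exclusion_edge_rotate1)

lemma inj_rotate: "inj (rotate k)"
  unfolding rotate_def by (simp add: inj_rotate1 inj_fn)

lemma finite_necklace: "finite (necklace u)"
proof -
  have "necklace u \<subseteq> {v. set v \<subseteq> set u \<and> length v = length u}"
    by (auto simp: necklace_def)
  then show ?thesis
    using finite_lists_length_eq[of "set u" "length u"] by (simp add: finite_subset)
qed

lemma self_in_necklace: "u \<in> necklace u"
  unfolding necklace_def by (rule range_eqI[of _ _ 0]) simp

lemma rotate_in_necklace: "v \<in> necklace u \<Longrightarrow> rotate k v \<in> necklace u"
  by (auto simp: necklace_def rotate_rotate)

lemma in_necklace_sym: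
  assumes "v \<in> necklace u"
  shows "u \<in> necklace v"
proof -
  from assms obtain k where v: "v = rotate k u" by (auto simp: necklace_def)
  define N where "N = length u"
  have "rotate (k * N - k) v = u" if "N > 0"
  proof -
    have "k * N - k + k = k * N" using that by simp
    then show ?thesis by (simp add: v rotate_rotate N_def)
  qed
  moreover have "rotate 0 v = u" if "N = 0"
    using that by (simp add: v N_def)
  ultimately show ?thesis
    unfolding necklace_def by (metis gr0I rangeI)
qed

lemma necklace_card_le:
  assumes G: "\<And>k u v. G u v \<Longrightarrow> G (rotate k u) (rotate k v)"
    and u': "u' \<in> necklace u"
  shows "card {v \<in> necklace b. G u v} \<le> card {v \<in> necklace b. G u' v}"
proof -
  from u' obtain k where k: "u' = rotate k u" by (auto simp: necklace_def)
  show ?thesis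
  proof (rule card_inj_on_le)
    show "inj_on (rotate k) {v \<in> necklace b. G u v}"
      using inj_rotate inj_on_subset by blast
    show "rotate k ` {v \<in> necklace b. G u v} \<subseteq> {v \<in> necklace b. G u' v}"
      using G rotate_in_necklace k by auto
    show "finite {v \<in> necklace b. G u' v}"
      using finite_necklace by simp
  qed
qed

lemma necklace_mult_eq:
  assumes G: "\<And>k u v. G u v \<Longrightarrow> G (rotate k u) (rotate k v)"
    and u: "u \<in> necklace a"
  shows "necklace_mult G (necklace a) (necklace b) = card {v \<in> necklace b. G u v}"
proof -
  have "card {v \<in> necklace b. G u' v} = card {v \<in> necklace b. G a v}"
    if "u' \<in> necklace a" for u'
    using necklace_card_le[of G, OF G] that in_necklace_sym[OF that] by (meson le_antisym)
  then show ?thesis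
    unfolding necklace_mult_def using u self_in_necklace[of a]
    by (intro the_equality) (metis, metis)
qed

lemma forward_mult_eq:
  "u \<in> necklace a \<Longrightarrow>
     necklace_mult exclusion_edge (necklace a) (necklace b) = card {v \<in> necklace b. exclusion_edge u v}"
  by (rule necklace_mult_eq) (rule exclusion_edge_rotate)

lemma backward_mult_eq:
  assumes "v \<in> necklace b"
  shows "necklace_mult exclusion_edge\<inverse>\<inverse> (necklace b) (necklace a) =
    card {u \<in> necklace a. exclusion_edge u v}"
  using necklace_mult_eq[OF _ assms, of "exclusion_edge\<inverse>\<inverse>" a] exclusion_edge_rotate by auto

lemma card_necklace_mult:
  "card (necklace a) * necklace_mult exclusion_edge (necklace a) (necklace b) =
   card (necklace b) * necklace_mult exclusion_edge\<inverse>\<inverse> (necklace b) (necklace a)"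
proof -
  have "card (necklace a) * necklace_mult exclusion_edge (necklace a) (necklace b) =
      (\<Sum>u\<in>necklace a. card {v \<in> necklace b. exclusion_edge u v})"
    by (simp add: forward_mult_eq[symmetric])
  also have "\<dots> = (\<Sum>v\<in>necklace b. card {u \<in> necklace a. exclusion_edge u v})"
    by (rule sum_multicount_gen) (auto simp: finite_necklace)
  also have "\<dots> = card (necklace b) * necklace_mult exclusion_edge\<inverse>\<inverse> (necklace b) (necklace a)"
    by (simp add: backward_mult_eq[symmetric])
  finally show ?thesis .
qed

text \<open>
  For \<open>d = L = 2\<close> there are two edges from the necklace of 0101 to that of 0011, but only one
  edge of the exclusion process ends in 0011.
\<close>

lemma necklace_mult_asym:
  defines "A \<equiv> necklace [False, True, False, True]" and "B \<equiv> necklace [False, False, True, True]"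
  shows "necklace_mult exclusion_edge A B = 2" and "necklace_mult exclusion_edge\<inverse>\<inverse> B A = 1"
proof -
  have neck: "necklace u = {u, rotate1 u, rotate1 (rotate1 u), rotate1 (rotate1 (rotate1 u))}"
    (is "_ = ?R") if u: "length u = 4" for u :: "bool list"
  proof
    show "necklace u \<subseteq> ?R"
    proof
      fix v assume "v \<in> necklace u"
      then obtain k where k: "v = rotate (k mod 4) u"
        unfolding necklace_def using rotate_conv_mod u by (metis imageE)
      define m where "m = k mod 4"
      have "m = 0 \<or> m = 1 \<or> m = 2 \<or> m = 3"
        unfolding m_def by linarith
      moreover have "v = rotate m u"
        using k by (simp only: m_def)
      ultimately show "v \<in> ?R"
        by (elim disjE) (simp_all add: numeral_2_eq_2 numeral_3_eq_3)
    qed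
    have "rotate 0 u \<in> necklace u" "rotate 1 u \<in> necklace u" "rotate 2 u \<in> necklace u"
      "rotate 3 u \<in> necklace u"
      by (simp_all only: rotate_in_necklace self_in_necklace)
    then show "?R \<subseteq> necklace u"
      by (simp add: numeral_2_eq_2 numeral_3_eq_3)
  qed
  have ex4: "(\<exists>r<4. P r) \<longleftrightarrow> P 0 \<or> P 1 \<or> P 2 \<or> P 3" for P :: "nat \<Rightarrow> bool"
    by (simp add: numeral_eq_Suc Ex_less_Suc2)
  have all4: "(\<forall>r<4. P r) \<longleftrightarrow> P 0 \<and> P 1 \<and> P 2 \<and> P 3" for P :: "nat \<Rightarrow> bool"
    by (simp add: numeral_eq_Suc All_less_Suc2)
  have edge: "exclusion_edge u v \<longleftrightarrow> length v = 4 \<and>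
      (\<exists>r<4. let q = (r + 3) mod 4 in
        \<not> u ! q \<and> u ! r \<and> v ! q \<and> \<not> v ! r \<and>
        (\<forall>t<4. t \<notin> {q, r} \<longrightarrow> v ! t = u ! t))" if "length u = 4" for u v
    using that by (simp add: exclusion_edge_def add.commute)
  have A: "A = {[False, True, False, True], [True, False, True, False]}"
    unfolding A_def by (subst neck) auto
  have B: "B = {[False, False, True, True], [False, True, True, False],
      [True, True, False, False], [True, False, False, True]}"
    unfolding B_def by (subst neck) auto
  have e: "\<not> exclusion_edge [False, True, False, True] [False, False, True, True]"
    "exclusion_edge [False, True, False, True] [False, True, True, False]"
    "\<not> exclusion_edge [False, True, False, True] [True, True, False, False]"
    "exclusion_edge [False, True, False, True] [True, False, False, True]"
    by (simp_all add: edge ex4 all4 Let_def)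
  have e': "exclusion_edge [True, False, True, False] [False, False, True, True]"
    using exclusion_edge_rotate[OF e(4), of 1] by simp
  have "{v \<in> B. exclusion_edge [False, True, False, True] v} =
      {[True, False, False, True], [False, True, True, False]}"
    using e by (auto simp: B)
  then show "necklace_mult exclusion_edge A B = 2"
    using forward_mult_eq[OF self_in_necklace, of "[False, True, False, True]"]
    by (simp add: A_def B_def)
  have "{u \<in> A. exclusion_edge u [False, False, True, True]} = {[True, False, True, False]}"
    using e(1) e' by (auto simp: A)
  then show "necklace_mult exclusion_edge\<inverse>\<inverse> B A = 1"
    using backward_mult_eq[OF self_in_necklace, of "[False, False, True, True]"]
    by (simp add: A_def B_def)
qed


section \<open>The maps\<close>

definition shape_diffs :: "nat \<Rightarrow> (int \<Rightarrow> int) \<Rightarrow> nat list" where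
  "shape_diffs d f = map (\<lambda>i. nat (f (i - 1) - f i)) [1..int d]"

definition simplex_state :: "nat list \<Rightarrow> bool list" where
  "simplex_state x = concat (map (\<lambda>m. replicate m False @ [True]) x)"

text \<open>
  The boundary of a shape \<open>f\<close> is a doubly infinite lattice path whose word has its ones at the
  positions \<open>i - f i + c\<close>, \<open>i \<in> \<int>\<close>; this word has period \<open>d + L\<close>. The state below is its window
  \<open>1, \<dots>, d + L\<close>. With \<open>c = f 0\<close> it is \<open>simplex_state (shape_diffs d f)\<close>, and while a cell is added
  or removed \<open>c\<close> has to be kept fixed.
\<close>

definition shape_state :: "nat \<Rightarrow> nat \<Rightarrow> int \<Rightarrow> (int \<Rightarrow> int) \<Rightarrow> bool list" where
  "shape_state d L c f = map (\<lambda>p. \<exists>i. int p + 1 = i - f i + c) [0..<d + L]"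

end

theory Submission
  imports Defs
begin

text \<open>
  An oscillating walk of a given type is built one step at a time, so each correspondence follows
  from a local one: if the shapes one step away from \<open>f\<close> are mapped bijectively to the
  vertices one step away from the image of \<open>f\<close>, in the forward and in the backward direction, then
  walks lift uniquely along the map (\<open>osc_walks_cover\<close>). For necklaces, the number of states of a
  necklace one step away from a given state is by definition the number of parallel edges, so
  labelling these states by the edges turns the passage to necklaces into such a local bijection
  as well (\<open>osc_walks_multi_cover\<close>).

  The shapes one step away from \<open>f\<close> are among the functions \<open>bump d i s f\<close>, which add \<open>s = \<plusminus>1\<close> to
  all the rows congruent to \<open>i\<close> modulo \<open>d\<close>. The only obstruction to such a step is that the
  result may fail to be weakly decreasing, and both encodings see exactly this.

  For the simplex, a bump in row \<open>i\<close> changes the differences of consecutive rows by \<open>\<plusminus>s\<^sub>i\<close>, and the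
  result is decreasing iff the new differences are nonnegative; the vectors \<open>s\<^sub>i\<close> are distinct, so
  the row can be recovered (\<open>shape_diffs_local_bij\<close>).

  For the exclusion process, a shape is a strictly increasing sequence of beads at \<open>i - f i + c\<close>,
  whose set of positions is periodic with period \<open>d + L\<close>; a state is one window of that
  set. Adding a cell in row \<open>i\<close> moves the bead \<open>i\<close> and its translates one place to the left, which
  leaves the sequence strictly increasing iff the place is free. This is an edge of the exclusion
  process, and the bead that moved determines the row modulo \<open>d\<close>
  (\<open>shape_state_local_bij\<close>).

  Backward steps are treated together with forward ones by means of the sign \<open>s\<close>.
\<close>

section \<open>Walks and local bijections\<close>

definition step :: "('a \<Rightarrow> 'a \<Rightarrow> bool) \<Rightarrow> sign \<Rightarrow> 'a \<Rightarrow> 'a \<Rightarrow> bool" where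
  "step E s a b \<longleftrightarrow> (case s of Plus \<Rightarrow> E a b | Minus \<Rightarrow> E b a)"

lemma all_less_Suc_length:
  "(\<forall>k<length (y # ys). P k) \<longleftrightarrow> P 0 \<and> (\<forall>k<length ys. P (Suc k))"
  by (simp add: All_less_Suc2)

lemma osc_walks_Nil: "a \<in> V \<Longrightarrow> osc_walks V E [] a = {[a]}"
  by (auto simp: osc_walks_def length_Suc_conv)

lemma osc_walks_Cons:
  assumes "a \<in> V"
  shows "osc_walks V E (s # w) a =
    {a # vs | b vs. b \<in> V \<and> step E s a b \<and> vs \<in> osc_walks V E w b}" (is "?l = ?r")
proof
  show "?l \<subseteq> ?r"
  proof
    fix us assume us: "us \<in> ?l"
    then obtain b vs where "us = a # b # vs" "length vs = length w"
      by (auto simp: osc_walks_def length_Suc_conv)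
    with us show "us \<in> ?r"
      unfolding osc_walks_def all_less_Suc_length nth_Cons_0 nth_Cons_Suc step_def
    by (auto split: sign.splits)
  qed
next
  show "?r \<subseteq> ?l"
    using assms unfolding osc_walks_def all_less_Suc_length nth_Cons_0 nth_Cons_Suc step_def
    by (auto split: sign.splits)
qed

lemma osc_walks_hd: "vs \<in> osc_walks V E w a \<Longrightarrow> \<exists>vs'. vs = a # vs'"
  by (cases vs) (auto simp: osc_walks_def)

text \<open>
  The unique lifting of walks: the vertex \<open>a\<close> above \<open>\<phi> a\<close> is known, and \<open>loc\<close> says that the next
  vertex of a walk downstairs has exactly one preimage among the vertices one step away from \<open>a\<close>.
  Injectivity of \<open>\<phi>\<close> on all of \<open>V\<close> may well fail; the starting point is what pins the lift down.
\<close>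

lemma osc_walks_cover:
  assumes loc: "\<And>s a. a \<in> V \<Longrightarrow>
      bij_betw \<phi> {b \<in> V. step E s a b} {b' \<in> V'. step E' s (\<phi> a) b'}"
    and \<phi>: "\<And>a. a \<in> V \<Longrightarrow> \<phi> a \<in> V'"
    and "a \<in> V"
  shows "bij_betw (map \<phi>) (osc_walks V E w a) (osc_walks V' E' w (\<phi> a))"
  using \<open>a \<in> V\<close>
proof (induction w arbitrary: a)
  case Nil
  then show ?case by (simp add: osc_walks_Nil \<phi> bij_betw_def)
next
  case (Cons s w)
  note W = osc_walks_Cons[OF \<open>a \<in> V\<close>, of E s w] osc_walks_Cons[OF \<phi>[OF \<open>a \<in> V\<close>], of E' s w]
  note inj = bij_betw_imp_inj_on[OF loc[OF \<open>a \<in> V\<close>, of s]]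
  note img = bij_betw_imp_surj_on[OF loc[OF \<open>a \<in> V\<close>, of s]]
  show ?case
    unfolding bij_betw_def
  proof
    show "inj_on (map \<phi>) (osc_walks V E (s # w) a)"
    proof (rule inj_onI)
      fix us us'
      assume "us \<in> osc_walks V E (s # w) a" "us' \<in> osc_walks V E (s # w) a"
        and eq: "map \<phi> us = map \<phi> us'"
      then obtain b vs b' vs' where
        u: "us = a # vs" "b \<in> V" "step E s a b" "vs \<in> osc_walks V E w b" and
        u': "us' = a # vs'" "b' \<in> V" "step E s a b'" "vs' \<in> osc_walks V E w b'"
        by (auto simp: W)
      have "\<phi> b = \<phi> b'"
        using u u' eq osc_walks_hd[OF u(4)] osc_walks_hd[OF u'(4)] by auto
      then have "b = b'"
        using inj u u' by (auto dest: inj_onD)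
      then show "us = us'"
        using Cons.IH[OF \<open>b \<in> V\<close>] u u' eq by (auto simp: bij_betw_def dest: inj_onD)
    qed
    show "map \<phi> ` osc_walks V E (s # w) a = osc_walks V' E' (s # w) (\<phi> a)"
    proof safe
      fix us assume "us \<in> osc_walks V E (s # w) a"
      then obtain b vs where
        u: "us = a # vs" "b \<in> V" "step E s a b" "vs \<in> osc_walks V E w b"
        by (auto simp: W)
      have "step E' s (\<phi> a) (\<phi> b)" "map \<phi> vs \<in> osc_walks V' E' w (\<phi> b)"
        using img u Cons.IH[OF \<open>b \<in> V\<close>] by (auto simp: bij_betw_def)
      then show "map \<phi> us \<in> osc_walks V' E' (s # w) (\<phi> a)"
        using u \<phi> by (auto simp: W)
    next
      fix ys assume "ys \<in> osc_walks V' E' (s # w) (\<phi> a)"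
      then obtain y zs where
        y: "ys = \<phi> a # zs" "y \<in> V'" "step E' s (\<phi> a) y" "zs \<in> osc_walks V' E' w y"
        by (auto simp: W)
      then obtain b where b: "b \<in> V" "step E s a b" "y = \<phi> b"
        using img by blast
      then obtain vs where "vs \<in> osc_walks V E w b" "zs = map \<phi> vs"
        using Cons.IH[OF \<open>b \<in> V\<close>] y by (auto simp: bij_betw_def)
      then show "ys \<in> map \<phi> ` osc_walks V E (s # w) a"
        using b y by (auto simp: W intro!: image_eqI[of _ _ "a # vs"])
    qed
  qed
qed

lemma multi_osc_walks_Nil: "a \<in> V \<Longrightarrow> multi_osc_walks V f g [] a = {([a], [])}"
  by (auto simp: multi_osc_walks_def length_Suc_conv)

lemma multi_osc_walks_Cons:
  assumes "a \<in> V"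
  shows "multi_osc_walks V f g (s # w) a =
    {(a # vs, k # ks) | b vs k ks. b \<in> V \<and> k < (case s of Plus \<Rightarrow> f a b | Minus \<Rightarrow> g a b) \<and>
       (vs, ks) \<in> multi_osc_walks V f g w b}" (is "?l = ?r")
proof
  show "?l \<subseteq> ?r"
  proof
    fix p assume p: "p \<in> ?l"
    then obtain b vs k ks where "p = (a # b # vs, k # ks)" "length vs = length w" "length ks = length w"
      by (auto simp: multi_osc_walks_def length_Suc_conv)
    with p show "p \<in> ?r"
      unfolding multi_osc_walks_def all_less_Suc_length nth_Cons_0 nth_Cons_Suc
    by (auto split: sign.splits)
  qed
next
  show "?r \<subseteq> ?l"
    using assms unfolding multi_osc_walks_def all_less_Suc_length nth_Cons_0 nth_Cons_Suc
    by (auto split: sign.splits)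
qed

fun step_labels :: "(sign \<Rightarrow> 'a \<Rightarrow> 'a \<Rightarrow> nat) \<Rightarrow> sign list \<Rightarrow> 'a list \<Rightarrow> nat list" where
  "step_labels lab (s # w) (a # b # vs) = lab s a b # step_labels lab w (b # vs)"
| "step_labels lab _ _ = []"

text \<open>
  If the number of steps from \<open>a\<close> into the fibre over \<open>B\<close> is the number of parallel steps from \<open>\<phi> a\<close>
  to \<open>B\<close>, then numbering the former makes a step from \<open>a\<close> the same thing as a labelled
  step from \<open>\<phi> a\<close>, and walks lift uniquely. The numbering depends on \<open>a\<close> itself, not only on \<open>\<phi> a\<close>,
  which does no harm because the current vertex upstairs is known at each step.
\<close>

lemma osc_walks_multi_cover:
  assumes fin: "\<And>s a. a \<in> V \<Longrightarrow> finite {b \<in> V. step E s a b}"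
    and mult: "\<And>s a B. a \<in> V \<Longrightarrow> B \<in> V' \<Longrightarrow>
      card {b \<in> V. step E s a b \<and> \<phi> b = B} = (case s of Plus \<Rightarrow> f (\<phi> a) B | Minus \<Rightarrow> g (\<phi> a) B)"
    and \<phi>: "\<And>a. a \<in> V \<Longrightarrow> \<phi> a \<in> V'"
    and "a \<in> V"
  shows "\<exists>h. bij_betw h (osc_walks V E w a) (multi_osc_walks V' f g w (\<phi> a)) \<and>
    (\<forall>vs \<in> osc_walks V E w a. fst (h vs) = map \<phi> vs)"
proof -
  define m where "m s A B = (case s of Plus \<Rightarrow> f A B | Minus \<Rightarrow> g A B)" for s A B
  have ex: "\<exists>\<beta>. bij_betw \<beta> {b \<in> V. step E s a b \<and> \<phi> b = B} {..<m s (\<phi> a) B}"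
    if "a \<in> V" "B \<in> V'" for s a B
  proof -
    have "finite {b \<in> V. step E s a b \<and> \<phi> b = B}"
      by (rule finite_subset[OF _ fin[OF \<open>a \<in> V\<close>, of s]]) auto
    then show ?thesis
      by (rule finite_same_card_bij) (simp_all add: mult that m_def)
  qed
  define \<beta> where "\<beta> s a B = (SOME \<beta>.
    bij_betw \<beta> {b \<in> V. step E s a b \<and> \<phi> b = B} {..<m s (\<phi> a) B})" for s a B
  have \<beta>: "bij_betw (\<beta> s a B) {b \<in> V. step E s a b \<and> \<phi> b = B} {..<m s (\<phi> a) B}"
    if "a \<in> V" "B \<in> V'" for s a B
    unfolding \<beta>_def by (rule someI_ex[OF ex[OF that]])
  define lab where "lab = (\<lambda>s a b. \<beta> s a (\<phi> b) b)"
  define h where "h = (\<lambda>w vs. (map \<phi> vs, step_labels lab w vs))"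
  have lab_less: "lab s a b < m s (\<phi> a) (\<phi> b)" if "a \<in> V" "b \<in> V" "step E s a b" for s a b
    using bij_betw_apply[OF \<beta>[OF that(1) \<phi>[OF that(2)], of s], of b] that by (simp add: lab_def)
  have lab_inj: "b = b'" if "a \<in> V" "b \<in> V" "b' \<in> V" "step E s a b" "step E s a b'"
      "\<phi> b = \<phi> b'" "lab s a b = lab s a b'" for s a b b'
    using inj_onD[OF bij_betw_imp_inj_on[OF \<beta>[OF that(1) \<phi>[OF that(2)], of s]], of b b'] that
    by (simp add: lab_def)
  have lab_surj: "\<exists>b\<in>V. step E s a b \<and> \<phi> b = B \<and> lab s a b = k"
    if "a \<in> V" "B \<in> V'" "k < m s (\<phi> a) B" for s a B k
  proof -
    have "k \<in> \<beta> s a B ` {b \<in> V. step E s a b \<and> \<phi> b = B}"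
      using bij_betw_imp_surj_on[OF \<beta>[OF that(1,2), of s]] that(3) by simp
    then show ?thesis
      by (auto simp: lab_def)
  qed
  have "bij_betw (h w) (osc_walks V E w a) (multi_osc_walks V' f g w (\<phi> a))"
    using \<open>a \<in> V\<close>
  proof (induction w arbitrary: a)
    case Nil
    then show ?case by (simp add: osc_walks_Nil multi_osc_walks_Nil \<phi> bij_betw_def h_def)
  next
    case (Cons s w)
    note W = osc_walks_Cons[OF \<open>a \<in> V\<close>, of E s w]
      multi_osc_walks_Cons[OF \<phi>[OF \<open>a \<in> V\<close>], of f g s w, folded m_def]
    have h_Cons: "h (s # w) (a # vs) = (\<phi> a # map \<phi> vs, lab s a b # step_labels lab w vs)"
      if "vs \<in> osc_walks V E w b" for b vs
      using osc_walks_hd[OF that] by (auto simp: h_def)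
    show ?case
      unfolding bij_betw_def
    proof
      show "inj_on (h (s # w)) (osc_walks V E (s # w) a)"
      proof (rule inj_onI)
        fix us us'
        assume "us \<in> osc_walks V E (s # w) a" "us' \<in> osc_walks V E (s # w) a"
          and eq: "h (s # w) us = h (s # w) us'"
        then obtain b vs b' vs' where
          u: "us = a # vs" "b \<in> V" "step E s a b" "vs \<in> osc_walks V E w b" and
          u': "us' = a # vs'" "b' \<in> V" "step E s a b'" "vs' \<in> osc_walks V E w b'"
          by (auto simp: W)
        have e: "map \<phi> vs = map \<phi> vs'" "lab s a b = lab s a b'"
          "step_labels lab w vs = step_labels lab w vs'"
          using eq h_Cons[OF u(4)] h_Cons[OF u'(4)] u(1) u'(1) by auto
        then have "\<phi> b = \<phi> b'"
          using osc_walks_hd[OF u(4)] osc_walks_hd[OF u'(4)] by auto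
        then have "b = b'"
          using lab_inj \<open>a \<in> V\<close> u u' e by blast
        moreover have "h w vs = h w vs'"
          using e by (simp add: h_def)
        ultimately show "us = us'"
          using Cons.IH[OF \<open>b \<in> V\<close>] u u' by (auto simp: bij_betw_def dest: inj_onD)
      qed
      show "h (s # w) ` osc_walks V E (s # w) a = multi_osc_walks V' f g (s # w) (\<phi> a)"
      proof (intro equalityI subsetI)
        fix p assume "p \<in> h (s # w) ` osc_walks V E (s # w) a"
        then obtain b vs where
          u: "p = h (s # w) (a # vs)" "b \<in> V" "step E s a b" "vs \<in> osc_walks V E w b"
          by (auto simp: W)
        have "h w vs \<in> multi_osc_walks V' f g w (\<phi> b)"
          using u Cons.IH[OF \<open>b \<in> V\<close>] by (auto simp: bij_betw_def)
        then show "p \<in> multi_osc_walks V' f g (s # w) (\<phi> a)"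
          unfolding u(1) h_Cons[OF u(4)] W using u \<phi> lab_less[OF \<open>a \<in> V\<close>] by (auto simp: h_def)
      next
        fix p assume "p \<in> multi_osc_walks V' f g (s # w) (\<phi> a)"
        then obtain B Bs k ks where
          y: "p = (\<phi> a # Bs, k # ks)" "B \<in> V'" "k < m s (\<phi> a) B"
          "(Bs, ks) \<in> multi_osc_walks V' f g w B"
          by (auto simp: W)
        then obtain b where b: "b \<in> V" "step E s a b" "B = \<phi> b" "lab s a b = k"
          using lab_surj[OF \<open>a \<in> V\<close>] by blast
        then obtain vs where vs: "vs \<in> osc_walks V E w b" "(Bs, ks) = h w vs"
          using Cons.IH[OF \<open>b \<in> V\<close>] y by (auto simp: bij_betw_def)
        have "p = h (s # w) (a # vs)"
          using h_Cons[OF vs(1)] vs(2) y b by (simp add: h_def)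
        then show "p \<in> h (s # w) ` osc_walks V E (s # w) a"
          using b vs by (auto simp: W)
      qed
    qed
  qed
  then show ?thesis
    by (auto simp: h_def intro!: exI[of _ "h w"])
qed


section \<open>Necklaces\<close>

lemma necklace_eq_iff: "necklace u = necklace v \<longleftrightarrow> u \<in> necklace v"
proof
  have sub: "necklace a \<subseteq> necklace b" if "a \<in> necklace b" for a b
    using rotate_in_necklace[OF that] by (auto simp: necklace_def[of a])
  show "necklace u = necklace v" if "u \<in> necklace v"
    using sub[OF that] sub[OF in_necklace_sym[OF that]] by blast
qed (use self_in_necklace in auto)

lemma rotate_in_states: "u \<in> states d L \<Longrightarrow> rotate k u \<in> states d L"
proof -
  have "count_list (rotate k u) b =
      count_list (take (k mod length u) u @ drop (k mod length u) u) b" for b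
    unfolding rotate_drop_take count_list_append by simp
  then show "u \<in> states d L \<Longrightarrow> rotate k u \<in> states d L"
    by (simp add: states_def)
qed

lemma finite_states: "finite (states d L)"
  by (rule finite_subset[OF _ finite_lists_length_eq[of UNIV "d + L"]]) (auto simp: states_def)

text \<open>
  The fibre of the passage to necklaces is the necklace itself, and both multiplicities count the
  states of the target necklace one step away from a representative of the necklace where the step
  starts. This is precisely the count that \<open>osc_walks_multi_cover\<close> asks for, in both directions.
\<close>

lemma exclusion_walks_bij_necklace_walks:
  assumes "u \<in> states d L"
  shows "\<exists>h. bij_betw h (exclusion_walks d L w u) (necklace_walks d L w (necklace u)) \<and>
    (\<forall>us \<in> exclusion_walks d L w u. fst (h us) = map necklace us)"
  unfolding exclusion_walks_def necklace_walks_def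
proof (rule osc_walks_multi_cover[OF _ _ _ assms])
  fix s a B assume a: "a \<in> states d L" and "B \<in> necklace ` states d L"
  then obtain b where b: "b \<in> states d L" "B = necklace b" by auto
  have "{v \<in> states d L. step exclusion_edge s a v \<and> necklace v = B} =
      {v \<in> necklace b. step exclusion_edge s a v}"
    using b rotate_in_states[OF b(1)] unfolding b(2) necklace_eq_iff
    by (auto simp: necklace_def)
  then show "card {v \<in> states d L. step exclusion_edge s a v \<and> necklace v = B} =
      (case s of Plus \<Rightarrow> necklace_mult exclusion_edge (necklace a) B
               | Minus \<Rightarrow> necklace_mult exclusion_edge\<inverse>\<inverse> (necklace a) B)"
    using forward_mult_eq[OF self_in_necklace, of a b] backward_mult_eq[OF self_in_necklace, of a b]
    by (simp add: b(2) step_def split: sign.split)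
qed (auto simp: finite_states)


section \<open>Shapes\<close>

lemma cyl_shapes_periodic:
  assumes "f \<in> cyl_shapes d L"
  shows "f (i + k * int d) = f i - k * int L"
proof -
  have p: "f (i + int d) = f i - int L" for i
  proof -
    have "f i = f (i + int d) + int L"
      using assms unfolding cyl_shapes_def by blast
    then show ?thesis by linarith
  qed
  show ?thesis
  proof (induction k rule: int_induct[of _ 0])
    case (step1 k)
    then show ?case using p[of "i + k * int d"] by (simp add: algebra_simps)
  next
    case (step2 k)
    then show ?case using p[of "i + (k - 1) * int d"] by (simp add: algebra_simps)
  qed simp
qed

lemma cyl_shapes_antimono: "f \<in> cyl_shapes d L \<Longrightarrow> antimono f"
  unfolding cyl_shapes_def by blast

lemma cyl_shapesI:
  assumes p: "\<And>i. f i = f (i + int d) + int L" and le: "\<And>j. f (j + 1) \<le> f j"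
  shows "f \<in> cyl_shapes d L"
proof -
  have "f j \<le> f i" if "i \<le> j" for i j
    using that
  proof (induction j rule: int_ge_induct)
    case (step j)
    then show ?case using le[of j] by simp
  qed simp
  then have "antimono f" by (simp add: monotone_def)
  then show ?thesis using p unfolding cyl_shapes_def by blast
qed

text \<open>
  Adding \<open>s\<close> cells in row \<open>i\<close> of a shape: periodicity forces the same change in every row congruent
  to \<open>i\<close> modulo \<open>d\<close>. Removing a cell is the case \<open>s = -1\<close>.
\<close>

definition bump :: "nat \<Rightarrow> int \<Rightarrow> int \<Rightarrow> (int \<Rightarrow> int) \<Rightarrow> int \<Rightarrow> int" where
  "bump d i s f = (\<lambda>j. f j + s * of_bool (int d dvd j - i))"

lemma dvd_diff_window:
  assumes "i \<in> {1..int d}" "j \<in> {1..int d}"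
  shows "int d dvd j - i \<longleftrightarrow> j = i"
proof
  assume "int d dvd j - i"
  then show "j = i"
    using assms zdvd_not_zless[of "j - i" "int d"] zdvd_not_zless[of "i - j" "int d"]
    by (cases j i rule: linorder_cases) (auto simp: dvd_diff_commute)
qed simp

lemma obtain_window_row:
  assumes "d \<ge> 1"
  obtains i k where "i \<in> {1..int d}" "j = i + k * int d"
proof
  have "0 \<le> (j - 1) mod int d" "(j - 1) mod int d < int d"
    using assms by simp_all
  then show "(j - 1) mod int d + 1 \<in> {1..int d}" by simp
  show "j = (j - 1) mod int d + 1 + ((j - 1) div int d) * int d"
    using div_mult_mod_eq[of "j - 1" "int d"] by simp
qed

lemma adds_cell_iff_bump:
  assumes d: "d \<ge> 1" and f: "f \<in> cyl_shapes d L" and g: "g \<in> cyl_shapes d L"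
  shows "adds_cell d f g \<longleftrightarrow> (\<exists>i\<in>{1..int d}. g = bump d i 1 f)"
proof
  assume "adds_cell d f g"
  then obtain i where i: "i \<in> {1..int d}" "g i = f i + 1"
    "\<And>j. j \<in> {1..int d} \<Longrightarrow> j \<noteq> i \<Longrightarrow> g j = f j"
    by (auto simp: adds_cell_def)
  have "g j = bump d i 1 f j" for j
  proof -
    obtain j0 k where j: "j0 \<in> {1..int d}" "j = j0 + k * int d"
      using obtain_window_row[OF d] by metis
    have "int d dvd j - i \<longleftrightarrow> int d dvd j0 - i"
      unfolding j(2) by (metis add_diff_eq add.commute dvd_add_times_triv_right_iff diff_add_eq)
    then have "int d dvd j - i \<longleftrightarrow> j0 = i"
      using dvd_diff_window[OF i(1) j(1)] by simp
    then show ?thesis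
      using i(2,3) j cyl_shapes_periodic[OF f, of j0 k] cyl_shapes_periodic[OF g, of j0 k]
      by (cases "j0 = i") (auto simp: bump_def)
  qed
  then show "\<exists>i\<in>{1..int d}. g = bump d i 1 f" using i(1) by blast
next
  assume "\<exists>i\<in>{1..int d}. g = bump d i 1 f"
  then show "adds_cell d f g"
    unfolding adds_cell_def bump_def using dvd_diff_window by auto
qed

definition sign_val :: "sign \<Rightarrow> int" where
  "sign_val s = (case s of Plus \<Rightarrow> 1 | Minus \<Rightarrow> - 1)"

lemma bump_bump_uminus: "bump d i (- s) (bump d i s f) = f"
  by (auto simp: bump_def)

lemma step_adds_cell_iff:
  assumes "d \<ge> 1" and "f \<in> cyl_shapes d L" and "g \<in> cyl_shapes d L"
  shows "step (adds_cell d) s f g \<longleftrightarrow> (\<exists>i\<in>{1..int d}. g = bump d i (sign_val s) f)"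
proof (cases s)
  case Plus
  then show ?thesis using adds_cell_iff_bump[OF assms] by (simp add: step_def sign_val_def)
next
  case Minus
  have "f = bump d i 1 g \<longleftrightarrow> g = bump d i (-1) f" for i
    using bump_bump_uminus[of d i 1 g] bump_bump_uminus[of d i "-1" f] by auto
  then show ?thesis
    using Minus adds_cell_iff_bump[OF assms(1,3,2)] by (simp add: step_def sign_val_def)
qed

lemma bump_periodic:
  assumes "f \<in> cyl_shapes d L"
  shows "bump d i s f j = bump d i s f (j + int d) + int L"
proof -
  have "int d dvd j + int d - i \<longleftrightarrow> int d dvd j - i"
    by (metis add_diff_eq add.commute dvd_add_triv_right_iff diff_add_eq)
  then show ?thesis
    using cyl_shapes_periodic[OF assms, of j 1] by (simp add: bump_def)
qed

text \<open>
  A step from \<open>f\<close> is the choice of a row \<open>i\<close>, so the hypothesis of \<open>osc_walks_cover\<close> for a map on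
  shapes can be checked on rows: images of steps are steps, the image determines the row, and
  each step downstairs comes from a row where the bump is again a shape.
\<close>

lemma local_bij_from_shapes:
  assumes d: "d \<ge> 1" and f: "f \<in> cyl_shapes d L"
    and into: "\<And>i g. i \<in> {1..int d} \<Longrightarrow> g = bump d i (sign_val s) f \<Longrightarrow> g \<in> cyl_shapes d L \<Longrightarrow>
      \<phi> g \<in> V' \<and> step E' s (\<phi> f) (\<phi> g)"
    and inj: "\<And>i i' g g'. i \<in> {1..int d} \<Longrightarrow> i' \<in> {1..int d} \<Longrightarrow>
      g = bump d i (sign_val s) f \<Longrightarrow> g' = bump d i' (sign_val s) f \<Longrightarrow>
      g \<in> cyl_shapes d L \<Longrightarrow> g' \<in> cyl_shapes d L \<Longrightarrow> \<phi> g = \<phi> g' \<Longrightarrow> i = i'"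
    and surj: "\<And>y. y \<in> V' \<Longrightarrow> step E' s (\<phi> f) y \<Longrightarrow>
      \<exists>i\<in>{1..int d}. bump d i (sign_val s) f \<in> cyl_shapes d L \<and> \<phi> (bump d i (sign_val s) f) = y"
  shows "bij_betw \<phi> {g \<in> cyl_shapes d L. step (adds_cell d) s f g} {y \<in> V'. step E' s (\<phi> f) y}"
proof -
  have N: "{g \<in> cyl_shapes d L. step (adds_cell d) s f g} =
      {g \<in> cyl_shapes d L. \<exists>i\<in>{1..int d}. g = bump d i (sign_val s) f}"
    using step_adds_cell_iff[OF d f] by blast
  show ?thesis
    unfolding bij_betw_def N
  proof
    show "inj_on \<phi> {g \<in> cyl_shapes d L. \<exists>i\<in>{1..int d}. g = bump d i (sign_val s) f}"
      using inj by (intro inj_onI) blast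
    show "\<phi> ` {g \<in> cyl_shapes d L. \<exists>i\<in>{1..int d}. g = bump d i (sign_val s) f} =
        {y \<in> V'. step E' s (\<phi> f) y}"
      using into surj by (intro equalityI subsetI) blast+
  qed
qed


section \<open>Shapes and the simplex\<close>

lemma length_shape_diffs [simp]: "length (shape_diffs d f) = d"
  by (simp add: shape_diffs_def)

lemma shape_diffs_nth:
  assumes "f \<in> cyl_shapes d L" "j < d"
  shows "int (shape_diffs d f ! j) = f (int j) - f (int j + 1)"
proof -
  have "f (int j + 1) \<le> f (int j)"
    using antimonoD[OF cyl_shapes_antimono[OF assms(1)]] by simp
  then show ?thesis
    using assms by (simp add: shape_diffs_def add.commute)
qed

lemma sum_take_shape_diffs:
  assumes "f \<in> cyl_shapes d L" "k \<le> d"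
  shows "int (sum_list (take k (shape_diffs d f))) = f 0 - f (int k)"
  using assms(2)
proof (induction k)
  case (Suc k)
  then have "take (Suc k) (shape_diffs d f) = take k (shape_diffs d f) @ [shape_diffs d f ! k]"
    by (simp add: take_Suc_conv_app_nth)
  then show ?case
    using Suc shape_diffs_nth[OF assms(1), of k] by (simp add: add.commute)
qed simp

lemma shape_diffs_in_simplex:
  assumes "f \<in> cyl_shapes d L"
  shows "shape_diffs d f \<in> simplex d L"
  using sum_take_shape_diffs[OF assms, of d] cyl_shapes_periodic[OF assms, of 0 1]
  by (simp add: simplex_def)

text \<open>
  Coordinate \<open>j\<close> of a point of the simplex, counted from 0, is the difference between the rows \<open>j\<close>
  and \<open>j + 1\<close>. So adding a cell in row \<open>i + 1\<close> lowers coordinate \<open>i\<close> and raises the next one; for \<open>i = d - 1\<close>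
  the next one is coordinate 0, because row 0 is a translate of row \<open>d\<close>. For \<open>d = 1\<close> the two
  changes cancel.
\<close>

lemma bump_diff:
  assumes "i < d" "j < d"
  shows "bump d (int i + 1) s f (int j) - bump d (int i + 1) s f (int j + 1) =
    f (int j) - f (int j + 1) + s * simplex_step d i j"
proof -
  have 1: "int d dvd (int j + 1) - (int i + 1) \<longleftrightarrow> j = i"
    using assms by (subst dvd_diff_window) auto
  have 2: "int d dvd int j - (int i + 1) \<longleftrightarrow> j = Suc i mod d"
  proof (cases "Suc i = d")
    case True
    then have "int d dvd int j - (int i + 1) \<longleftrightarrow> int d dvd int j"
      by (simp add: dvd_diff_left_iff algebra_simps flip: True)
    also have "\<dots> \<longleftrightarrow> j = 0" using assms(2) by (auto dest: dvd_imp_le)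
    finally show ?thesis using True by simp
  next
    case False
    have "int d dvd (int j + 1) - (int i + 2) \<longleftrightarrow> int j + 1 = int i + 2"
      using assms False by (intro dvd_diff_window) auto
    moreover have "(int j + 1) - (int i + 2) = int j - (int i + 1)" by simp
    ultimately show ?thesis using False assms by auto
  qed
  show ?thesis
    unfolding bump_def simplex_step_def 1 2 by (simp add: algebra_simps)
qed

text \<open>For \<open>d > 1\<close> the index is recovered as the only coordinate that goes down.\<close>

lemma simplex_step_inj:
  assumes "i < d" "i' < d" "\<And>j. j < d \<Longrightarrow> simplex_step d i j = simplex_step d i' j"
  shows "i = i'"
proof (cases "d = 1")
  case False
  have "Suc i mod d \<noteq> i"
    using False assms(1) by (cases "Suc i = d") auto
  then have "simplex_step d i' i = -1"
    using assms(3)[OF assms(1)] by (simp add: simplex_step_def)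
  then show ?thesis by (cases "i = i'") (auto simp: simplex_step_def of_bool_def split: if_splits)
qed (use assms in auto)

lemma shape_diffs_bump:
  assumes "f \<in> cyl_shapes d L" "bump d (int i + 1) s f \<in> cyl_shapes d L" "i < d" "j < d"
  shows "int (shape_diffs d (bump d (int i + 1) s f) ! j) - int (shape_diffs d f ! j) =
    s * simplex_step d i j"
  using bump_diff[OF assms(3,4), of s f] shape_diffs_nth[OF assms(1,4)] shape_diffs_nth[OF assms(2,4)]
  by simp

lemma step_simplex_edge_iff:
  "step (simplex_edge d) s x y \<longleftrightarrow>
     (\<exists>i<d. \<forall>j<d. int (y ! j) - int (x ! j) = sign_val s * simplex_step d i j)"
proof -
  have "int (x ! j) - int (y ! j) = c \<longleftrightarrow> int (y ! j) - int (x ! j) = - c" for j c by auto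
  then show ?thesis
    by (cases s) (simp_all add: step_def sign_val_def simplex_edge_def)
qed

lemma window_rowE:
  assumes "i \<in> {1..int d}"
  obtains k where "k < d" "i = int k + 1"
  using assms by (intro that[of "nat (i - 1)"]) auto

text \<open>
  The new differences in rows \<open>1, \<dots>, d\<close> are the entries of \<open>y\<close>, which are natural numbers; the
  other differences repeat these by periodicity.
\<close>

lemma bump_in_cyl_shapes_of_simplex:
  assumes d: "d \<ge> 1" and f: "f \<in> cyl_shapes d L" and "i < d"
    and y: "\<And>j. j < d \<Longrightarrow> int (y ! j) - int (shape_diffs d f ! j) = s * simplex_step d i j"
  shows "bump d (int i + 1) s f \<in> cyl_shapes d L"
proof (rule cyl_shapesI, rule bump_periodic[OF f])
  fix j
  define g where "g = bump d (int i + 1) s f"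
  have per: "g (j + k * int d) = g j - k * int L" for j k
  proof (induction k rule: int_induct[of _ 0])
    case (step1 k)
    then show ?case
      using bump_periodic[OF f, of "int i + 1" s "j + k * int d"] by (simp add: g_def algebra_simps)
  next
    case (step2 k)
    then show ?case
      using bump_periodic[OF f, of "int i + 1" s "j + (k - 1) * int d"]
      by (simp add: g_def algebra_simps)
  qed simp
  obtain r k where "r \<in> {1..int d}" and j: "j + 1 = r + k * int d"
    using obtain_window_row[OF d] by metis
  then obtain m where m: "m < d" "r = int m + 1" by (elim window_rowE)
  have "g (int m) - g (int m + 1) = int (y ! m)"
    using bump_diff[OF \<open>i < d\<close> m(1), of s f] shape_diffs_nth[OF f m(1)] y[OF m(1)]
    by (simp add: g_def)
  moreover have "j = int m + k * int d" using j m by simp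
  then have "g j = g (int m) - k * int L" using per[of "int m" k] by simp
  moreover have "g (j + 1) = g (int m + 1) - k * int L" unfolding j m(2) by (rule per)
  ultimately have "g (j + 1) \<le> g j" by linarith
  then show "bump d (int i + 1) s f (j + 1) \<le> bump d (int i + 1) s f j"
    by (simp add: g_def)
qed

lemma shape_diffs_local_bij:
  assumes d: "d \<ge> 1" and f: "f \<in> cyl_shapes d L"
  shows "bij_betw (shape_diffs d) {g \<in> cyl_shapes d L. step (adds_cell d) s f g}
    {y \<in> simplex d L. step (simplex_edge d) s (shape_diffs d f) y}"
proof (rule local_bij_from_shapes[OF d f])
  fix i g assume "i \<in> {1..int d}" and g: "g = bump d i (sign_val s) f" "g \<in> cyl_shapes d L"
  then obtain k where "k < d" "i = int k + 1" by (elim window_rowE)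
  then show "shape_diffs d g \<in> simplex d L \<and>
      step (simplex_edge d) s (shape_diffs d f) (shape_diffs d g)"
    using shape_diffs_bump[OF f, of k "sign_val s"] g
    by (auto simp: shape_diffs_in_simplex step_simplex_edge_iff)
next
  fix i i' g g'
  assume i: "i \<in> {1..int d}" "i' \<in> {1..int d}"
    and g: "g = bump d i (sign_val s) f" "g' = bump d i' (sign_val s) f"
      "g \<in> cyl_shapes d L" "g' \<in> cyl_shapes d L"
    and eq: "shape_diffs d g = shape_diffs d g'"
  obtain k where k: "k < d" "i = int k + 1" using i(1) by (rule window_rowE)
  obtain k' where k': "k' < d" "i' = int k' + 1" using i(2) by (rule window_rowE)
  have "sign_val s * simplex_step d k j = sign_val s * simplex_step d k' j" if "j < d" for j
    using shape_diffs_bump[OF f g(3)[unfolded g(1) k(2)] k(1) that]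
      shape_diffs_bump[OF f g(4)[unfolded g(2) k'(2)] k'(1) that] eq[unfolded g(1,2) k(2) k'(2)]
    by auto
  then have "simplex_step d k j = simplex_step d k' j" if "j < d" for j
    using that by (cases s) (simp_all add: sign_val_def)
  then show "i = i'"
    using simplex_step_inj[OF k(1) k'(1)] k k' by simp
next
  fix y assume y: "y \<in> simplex d L" "step (simplex_edge d) s (shape_diffs d f) y"
  then obtain k where k: "k < d"
    and e: "\<And>j. j < d \<Longrightarrow> int (y ! j) - int (shape_diffs d f ! j) = sign_val s * simplex_step d k j"
    by (auto simp: step_simplex_edge_iff)
  let ?g = "bump d (int k + 1) (sign_val s) f"
  have g: "?g \<in> cyl_shapes d L"
    by (rule bump_in_cyl_shapes_of_simplex[OF d f k e])
  have "shape_diffs d ?g = y"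
  proof (rule nth_equalityI)
    fix j assume "j < length (shape_diffs d ?g)"
    then have "j < d" by simp
    from shape_diffs_bump[OF f g k this] e[OF this]
    show "shape_diffs d ?g ! j = y ! j" by linarith
  qed (use y in \<open>simp add: simplex_def\<close>)
  with g k show "\<exists>i\<in>{1..int d}. bump d i (sign_val s) f \<in> cyl_shapes d L \<and>
      shape_diffs d (bump d i (sign_val s) f) = y"
    by (intro bexI[of _ "int k + 1"]) auto
qed


section \<open>Shapes and the exclusion process\<close>

text \<open>
  Binary strings of length \<open>N\<close> are turned into \<open>N\<close>-periodic sets of integers, where arithmetic
  modulo \<open>N\<close> becomes translation. List position \<open>p\<close> corresponds to the integers congruent to
  \<open>p + 1\<close>, in accordance with the window \<open>1, \<dots>, N\<close>.
\<close>

definition pos :: "nat \<Rightarrow> int \<Rightarrow> nat" where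
  "pos N m = nat ((m - 1) mod int N)"

definition ones :: "bool list \<Rightarrow> int set" where
  "ones u = {m. u ! pos (length u) m}"

lemma pos_less: "N > 0 \<Longrightarrow> pos N m < N"
  by (simp add: pos_def nat_less_iff)

lemma pos_of_nat: "p < N \<Longrightarrow> pos N (int p + 1) = p"
  by (simp add: pos_def)

lemma pos_eq_iff: "N > 0 \<Longrightarrow> pos N k = pos N m \<longleftrightarrow> int N dvd k - m"
  by (simp add: pos_def mod_eq_dvd_iff eq_nat_nat_iff)

lemma dvd_pos: "N > 0 \<Longrightarrow> int N dvd int (pos N m) + 1 - m"
  by (simp add: pos_less pos_of_nat flip: pos_eq_iff)

lemma pos_pred:
  assumes "N > 0"
  shows "pos N (m - 1) = (pos N m + N - 1) mod N"
proof -
  let ?q = "(pos N m + N - 1) mod N"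
  have "int ?q = (int (pos N m) - 1) mod int N"
    using assms by (simp add: of_nat_mod of_nat_diff algebra_simps flip: add_diff_eq)
  also have "\<dots> = (m - 1 - 1) mod int N"
    using assms dvd_pos[OF assms, of m] by (simp add: mod_eq_dvd_iff algebra_simps)
  finally show ?thesis by (simp add: pos_def)
qed

lemma ones_cong:
  assumes "length u > 0" "int (length u) dvd k - m"
  shows "k \<in> ones u \<longleftrightarrow> m \<in> ones u"
  using assms pos_eq_iff[of "length u" k m] by (simp add: ones_def)

lemma ones_inject:
  assumes "length u = length v" "ones u = ones v"
  shows "u = v"
proof (rule nth_equalityI[OF assms(1)])
  fix p assume "p < length u"
  moreover have "int p + 1 \<in> ones u \<longleftrightarrow> int p + 1 \<in> ones v"
    by (simp add: assms(2))
  ultimately show "u ! p = v ! p"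
    using assms(1) by (simp add: ones_def pos_of_nat)
qed

text \<open>
  A particle at \<open>m\<close> moves \<open>s\<close> places to the left in a periodic configuration \<open>W\<close>, together with all
  its translates. For \<open>s = 1\<close> this is an edge of the exclusion process, for \<open>s = -1\<close> a reversed edge.
\<close>

definition hop :: "nat \<Rightarrow> int \<Rightarrow> int set \<Rightarrow> int set \<Rightarrow> int \<Rightarrow> bool" where
  "hop N s W W' m \<longleftrightarrow> m \<in> W \<and> m - s \<notin> W \<and>
     W' = W - {k. int N dvd k - m} \<union> {k. int N dvd k - (m - s)}"

lemma hop_reverse:
  assumes W: "\<And>k m. int N dvd k - m \<Longrightarrow> k \<in> W \<longleftrightarrow> m \<in> W"
    and s: "\<not> int N dvd s" and h: "hop N s W W' m"
  shows "hop N (- s) W' W (m - s)"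
proof -
  from h have m: "m \<in> W" "m - s \<notin> W"
    and W': "W' = W - {k. int N dvd k - m} \<union> {k. int N dvd k - (m - s)}"
    by (auto simp: hop_def)
  have "k \<in> W \<longleftrightarrow> k \<in> W' - {k. int N dvd k - (m - s)} \<union> {k. int N dvd k - m}" for k
  proof (cases "int N dvd k - m")
    case True
    then show ?thesis using W[OF True] m(1) by blast
  next
    case False
    then show ?thesis using W[of k "m - s"] m(2) unfolding W' by blast
  qed
  then show ?thesis
    using s unfolding hop_def by (auto simp: W')
qed

text \<open>
  For \<open>N = 1\<close> the source and the target of a move would be the same position; for \<open>N \<ge> 2\<close> they are
  distinct, and every integer reduces to a list position.
\<close>

lemma exclusion_edge_iff_hop:
  assumes len: "length u = N" "length v = N" and N: "N \<ge> 2"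
  shows "exclusion_edge u v \<longleftrightarrow> (\<exists>m. hop N 1 (ones u) (ones v) m)"
proof -
  have N0: "N > 0" using N by simp
  have mem: "k \<in> ones u \<longleftrightarrow> u ! pos N k" "k \<in> ones v \<longleftrightarrow> v ! pos N k" for k
    by (simp_all add: ones_def len)
  have ne: "pos N (m - 1) \<noteq> pos N m" for m
    using N by (simp add: pos_eq_iff zdvd1_eq)
  have all: "(\<forall>k. P (pos N k)) \<longleftrightarrow> (\<forall>t<N. P t)" for P
    using pos_less[OF N0] pos_of_nat by metis
  have hop: "hop N 1 (ones u) (ones v) m \<longleftrightarrow>
      u ! pos N m \<and> \<not> u ! pos N (m - 1) \<and>
      (\<forall>t<N. v ! t \<longleftrightarrow> u ! t \<and> t \<noteq> pos N m \<or> t = pos N (m - 1))" for m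
    unfolding hop_def set_eq_iff Un_iff Diff_iff mem_Collect_eq mem pos_eq_iff[OF N0, symmetric]
    using all[of "\<lambda>t. v ! t \<longleftrightarrow> u ! t \<and> t \<noteq> pos N m \<or> t = pos N (m - 1)"] by simp
  have edge: "exclusion_edge u v \<longleftrightarrow> (\<exists>r<N. \<exists>q. q = (r + N - 1) mod N \<and>
      \<not> u ! q \<and> u ! r \<and> v ! q \<and> \<not> v ! r \<and> (\<forall>t<N. t \<notin> {q, r} \<longrightarrow> v ! t = u ! t))"
    by (simp add: exclusion_edge_def Let_def len)
  show ?thesis
  proof
    assume "exclusion_edge u v"
    then obtain r where r: "r < N" and e: "\<not> u ! ((r + N - 1) mod N)" "u ! r"
      "v ! ((r + N - 1) mod N)" "\<not> v ! r"
      "\<And>t. t < N \<Longrightarrow> t \<noteq> (r + N - 1) mod N \<Longrightarrow> t \<noteq> r \<Longrightarrow> v ! t = u ! t"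
      unfolding edge by blast
    define m where "m = int r + 1"
    have pos: "r = pos N m" "(r + N - 1) mod N = pos N (m - 1)"
      using r by (simp_all add: m_def pos_of_nat pos_pred[OF N0, of "int r + 1", simplified])
    show "\<exists>m. hop N 1 (ones u) (ones v) m"
      using e[unfolded pos(2), unfolded pos(1)] by (intro exI[of _ m]) (auto simp: hop)
  next
    assume "\<exists>m. hop N 1 (ones u) (ones v) m"
    then obtain m where "hop N 1 (ones u) (ones v) m" by blast
    then have "\<not> u ! pos N (m - 1)" "u ! pos N m" "v ! pos N (m - 1)" "\<not> v ! pos N m"
      "\<forall>t<N. t \<notin> {pos N (m - 1), pos N m} \<longrightarrow> v ! t = u ! t"
      unfolding hop using pos_less[OF N0] ne[of m] by auto
    then show "exclusion_edge u v"
      unfolding edge using pos_less[OF N0] pos_pred[OF N0] by blast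
  qed
qed

lemma sign_val_cases: "sign_val s = 1 \<or> sign_val s = - 1"
  by (cases s) (simp_all add: sign_val_def)

lemma not_dvd_sign_val: "N \<ge> 2 \<Longrightarrow> \<not> int N dvd sign_val s"
  by (cases s) (auto simp: sign_val_def zdvd1_eq)

lemma step_exclusion_edge_iff_hop:
  assumes len: "length u = N" "length v = N" and N: "N \<ge> 2"
  shows "step exclusion_edge s u v \<longleftrightarrow> (\<exists>m. hop N (sign_val s) (ones u) (ones v) m)"
proof (cases s)
  case Plus
  then show ?thesis
    using exclusion_edge_iff_hop[OF assms] by (simp add: step_def sign_val_def)
next
  case Minus
  have per: "k \<in> ones u \<longleftrightarrow> m \<in> ones u" "k \<in> ones v \<longleftrightarrow> m \<in> ones v" if "int N dvd k - m" for k m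
    using ones_cong[of u k m] ones_cong[of v k m] len N that by auto
  have "hop N 1 (ones v) (ones u) m \<Longrightarrow> hop N (- 1) (ones u) (ones v) (m - 1)" for m
    using not_dvd_sign_val[OF N, of Plus] by (intro hop_reverse per) (auto simp: sign_val_def)
  moreover have "hop N (- 1) (ones u) (ones v) m \<Longrightarrow>
      hop N (- (- 1)) (ones v) (ones u) (m - (- 1))" for m
    using not_dvd_sign_val[OF N, of Minus] by (intro hop_reverse per) (auto simp: sign_val_def)
  ultimately show ?thesis
    using Minus exclusion_edge_iff_hop[OF len(2,1) N] by (auto simp: step_def sign_val_def)
qed

text \<open>
  The position of the one that row \<open>i\<close> contributes to the boundary word of \<open>f\<close>. Weak decrease
  of \<open>f\<close> amounts to strict increase of the beads.
\<close>

definition bead :: "int \<Rightarrow> (int \<Rightarrow> int) \<Rightarrow> int \<Rightarrow> int" where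
  "bead c f i = i - f i + c"

lemma bead_less_iff:
  assumes "f \<in> cyl_shapes d L"
  shows "bead c f i < bead c f j \<longleftrightarrow> i < j"
proof -
  have "bead c f i < bead c f j" if "i < j" for i j
    using antimonoD[OF cyl_shapes_antimono[OF assms], of i j] that by (simp add: bead_def)
  then have "strict_mono (bead c f)" by (rule strict_monoI)
  then show ?thesis by (rule strict_mono_less)
qed

lemma bead_eq_iff:
  assumes "f \<in> cyl_shapes d L"
  shows "bead c f i = bead c f j \<longleftrightarrow> i = j"
  using bead_less_iff[OF assms, of c i j] bead_less_iff[OF assms, of c j i] by auto

lemma bead_periodic:
  assumes "f \<in> cyl_shapes d L"
  shows "bead c f (i + k * int d) = bead c f i + k * int (d + L)"
  using cyl_shapes_periodic[OF assms, of i k] by (simp add: bead_def algebra_simps)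

text \<open>
  The map \<open>bead c f\<close> is injective and carries translation by \<open>d\<close> to translation by \<open>d + L\<close>; hence
  it carries the residue classes modulo \<open>d\<close> injectively to residue classes modulo \<open>d + L\<close>. This is how
  a row modulo \<open>d\<close> is recovered from the position of its bead in the window.
\<close>

lemma bead_cong_iff:
  assumes "f \<in> cyl_shapes d L"
  shows "int (d + L) dvd bead c f i - bead c f j \<longleftrightarrow> int d dvd i - j"
proof
  assume "int (d + L) dvd bead c f i - bead c f j"
  then obtain k where "bead c f i - bead c f j = int (d + L) * k" by (elim dvdE)
  then have "bead c f i = bead c f (j + k * int d)"
    using bead_periodic[OF assms, of c j k] by (simp add: algebra_simps)
  then show "int d dvd i - j" by (simp add: bead_eq_iff[OF assms])
next
  assume "int d dvd i - j"
  then obtain k where "i - j = int d * k" by (elim dvdE)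
  then have "i = j + k * int d" by (simp add: algebra_simps)
  then show "int (d + L) dvd bead c f i - bead c f j"
    using bead_periodic[OF assms, of c j k] by simp
qed

lemma bead_class:
  assumes "f \<in> cyl_shapes d L" "int (d + L) dvd m - bead c f i"
  shows "\<exists>k. m = bead c f (i + k * int d)"
proof -
  from assms(2) obtain k where "m - bead c f i = int (d + L) * k" by (elim dvdE)
  then have "m = bead c f (i + k * int d)"
    using bead_periodic[OF assms(1), of c i k] by (simp add: algebra_simps)
  then show ?thesis by blast
qed

lemma range_bead_cong:
  assumes "f \<in> cyl_shapes d L" "int (d + L) dvd k - m"
  shows "k \<in> range (bead c f) \<longleftrightarrow> m \<in> range (bead c f)"
proof -
  have "k \<in> range (bead c f)" if "m \<in> range (bead c f)" "int (d + L) dvd k - m" for k m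
    using bead_class[OF assms(1)] that by blast
  from this[of m k] this[of k m] assms(2) show ?thesis
    by (auto simp: dvd_diff_commute)
qed

lemma bead_bump: "bead c (bump d i s f) j = bead c f j - s * of_bool (int d dvd j - i)"
  by (simp add: bead_def bump_def)

lemma range_bead_bump:
  assumes f: "f \<in> cyl_shapes d L"
  shows "range (bead c (bump d i s f)) = range (bead c f) -
    {k. int (d + L) dvd k - bead c f i} \<union> {k. int (d + L) dvd k - (bead c f i - s)}"
    (is "_ = ?r")
proof (intro equalityI subsetI)
  fix m assume "m \<in> range (bead c (bump d i s f))"
  then obtain j where m: "m = bead c f j - s * of_bool (int d dvd j - i)"
    by (auto simp: bead_bump)
  show "m \<in> ?r"
    using bead_cong_iff[OF f, of c j i] m by (cases "int d dvd j - i") auto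
next
  fix m assume "m \<in> ?r"
  then consider j where "m = bead c f j" "\<not> int (d + L) dvd bead c f j - bead c f i"
    | "int (d + L) dvd (m + s) - bead c f i"
    by (auto simp: algebra_simps)
  then have "\<exists>j. m = bead c (bump d i s f) j"
  proof cases
    case 1
    then show ?thesis
      using bead_cong_iff[OF f] by (intro exI[of _ j]) (simp add: bead_bump)
  next
    case 2
    then obtain k where "m + s = bead c f (i + k * int d)"
      using bead_class[OF f] by blast
    then show ?thesis
      by (intro exI[of _ "i + k * int d"]) (simp add: bead_bump)
  qed
  then show "m \<in> range (bead c (bump d i s f))" by blast
qed

lemma shape_state_nth:
  "p < d + L \<Longrightarrow> shape_state d L c f ! p \<longleftrightarrow> int p + 1 \<in> range (bead c f)"
  by (auto simp: shape_state_def bead_def)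

lemma length_shape_state [simp]: "length (shape_state d L c f) = d + L"
  by (simp add: shape_state_def)

lemma ones_shape_state:
  assumes "d \<ge> 1" "f \<in> cyl_shapes d L"
  shows "ones (shape_state d L c f) = range (bead c f)"
proof (rule set_eqI)
  fix m
  have N: "d + L > 0" using assms(1) by simp
  show "m \<in> ones (shape_state d L c f) \<longleftrightarrow> m \<in> range (bead c f)"
    using range_bead_cong[OF assms(2) dvd_pos[OF N]] shape_state_nth[OF pos_less[OF N]]
    by (simp add: ones_def)
qed

text \<open>
  Each residue class of rows modulo \<open>d\<close> meets the window in exactly one bead, so the window has
  \<open>d\<close> ones.
\<close>

lemma shape_state_in_states:
  assumes d: "d \<ge> 1" and f: "f \<in> cyl_shapes d L"
  shows "shape_state d L c f \<in> states d L"
proof -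
  let ?u = "shape_state d L c f" and ?N = "d + L"
  have N: "?N > 0" using d by simp
  have "bij_betw (\<lambda>i. pos ?N (bead c f i)) {1..int d} {p. p < ?N \<and> ?u ! p}"
    unfolding bij_betw_def
  proof
    show "inj_on (\<lambda>i. pos ?N (bead c f i)) {1..int d}"
      using dvd_diff_window
      by (intro inj_onI) (auto simp: pos_eq_iff[OF N] bead_cong_iff[OF f] simp del: of_nat_add)
    show "(\<lambda>i. pos ?N (bead c f i)) ` {1..int d} = {p. p < ?N \<and> ?u ! p}"
    proof (intro equalityI subsetI)
      fix p assume "p \<in> (\<lambda>i. pos ?N (bead c f i)) ` {1..int d}"
      then obtain i where i: "p = pos ?N (bead c f i)" by blast
      have "bead c f i \<in> ones ?u" by (simp add: ones_shape_state[OF d f])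
      then show "p \<in> {p. p < ?N \<and> ?u ! p}"
        using pos_less[OF N] by (simp add: i ones_def)
    next
      fix p assume p: "p \<in> {p. p < ?N \<and> ?u ! p}"
      then obtain j where j: "int p + 1 = bead c f j"
        using shape_state_nth by blast
      obtain i k where i: "i \<in> {1..int d}" "j = i + k * int d"
        using obtain_window_row[OF d] by metis
      have "int d dvd i - j" by (simp add: i)
      then have "pos ?N (bead c f i) = pos ?N (bead c f j)"
        by (simp add: pos_eq_iff[OF N] bead_cong_iff[OF f] del: of_nat_add)
      also have "\<dots> = p" using p pos_of_nat[of p ?N] by (simp flip: j)
      finally show "p \<in> (\<lambda>i. pos ?N (bead c f i)) ` {1..int d}" using i(1) by blast
    qed
  qed
  then have "card {p. p < ?N \<and> ?u ! p} = d"
    using bij_betw_same_card by fastforce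
  then have "count_list ?u True = d"
    by (simp add: count_list_eq_length_filter length_filter_conv_card)
  then show ?thesis by (simp add: states_def)
qed

text \<open>
  Beads move by one place only, so two neighbours can stop being strictly increasing only if one
  lands on the old place of the other while that one rests. When neighbours move together, as for
  \<open>d = 1\<close>, nothing can go wrong.
\<close>

lemma bump_in_cyl_shapes_of_gap:
  assumes f: "f \<in> cyl_shapes d L" and s: "s = 1 \<or> s = -1"
    and gap: "bead c f i - s \<notin> range (bead c f)"
  shows "bump d i s f \<in> cyl_shapes d L"
proof (rule cyl_shapesI, rule bump_periodic[OF f])
  fix j
  have gap': "bead c f k - s \<noteq> bead c f k'" if "int d dvd k - i" for k k'
  proof -
    have "int (d + L) dvd bead c f k - bead c f i"
      using that bead_cong_iff[OF f] by blast
    then have "int (d + L) dvd (bead c f k - s) - (bead c f i - s)" by simp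
    from range_bead_cong[OF f this, of c] gap show ?thesis by auto
  qed
  have lt: "bead c f j < bead c f (j + 1)" by (simp add: bead_less_iff[OF f])
  have "bead c (bump d i s f) j < bead c (bump d i s f) (j + 1)"
    using lt s gap'[of j "j + 1"] gap'[of "j + 1" j]
    by (cases "int d dvd j - i"; cases "int d dvd j + 1 - i") (auto simp: bead_bump)
  then show "bump d i s f (j + 1) \<le> bump d i s f j"
    by (simp add: bead_def)
qed

text \<open>
  Positivity of both \<open>d\<close> and \<open>L\<close> gives \<open>d + L \<ge> 2\<close>, so that a bead that moves by one place leaves its
  residue class modulo \<open>d + L\<close>. Everything else is the translation between bumps and moves of beads.
\<close>

lemma shape_state_local_bij:
  assumes d: "d \<ge> 1" and L: "L \<ge> 1" and f: "f \<in> cyl_shapes d L"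
  shows "bij_betw (shape_state d L c) {g \<in> cyl_shapes d L. step (adds_cell d) s f g}
    {v \<in> states d L. step exclusion_edge s (shape_state d L c f) v}"
proof -
  define \<sigma> where "\<sigma> = sign_val s"
  have N: "d + L \<ge> 2" using d L by simp
  have nd: "\<not> int (d + L) dvd \<sigma>" using not_dvd_sign_val[OF N] by (simp add: \<sigma>_def)
  \<comment> \<open>A bump that yields a shape moves its bead to a free place: a bead there would be hit if it
    rests, and it cannot move along because it lies in another residue class.\<close>
  have gap: "bead c f i - \<sigma> \<notin> range (bead c f)"
    if g: "bump d i \<sigma> f \<in> cyl_shapes d L" for i
  proof
    assume "bead c f i - \<sigma> \<in> range (bead c f)"
    then obtain j where j: "bead c f j = bead c f i - \<sigma>" by (metis rangeE)
    show False
    proof (cases "int d dvd j - i")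
      case True
      then have "int (d + L) dvd bead c f j - bead c f i" using bead_cong_iff[OF f] by blast
      then show False using j nd by simp
    next
      case False
      then have "bead c (bump d i \<sigma> f) j = bead c (bump d i \<sigma> f) i"
        using j by (simp add: bead_bump)
      then show False using False by (simp add: bead_eq_iff[OF g])
    qed
  qed
  show ?thesis
  proof (rule local_bij_from_shapes[where s = s, OF d f, folded \<sigma>_def])
    fix i g assume g: "g = bump d i \<sigma> f" "g \<in> cyl_shapes d L"
    have "hop (d + L) \<sigma> (range (bead c f)) (range (bead c g)) (bead c f i)"
      unfolding hop_def using gap[of i] range_bead_bump[OF f] g by simp
    then show "shape_state d L c g \<in> states d L \<and>
        step exclusion_edge s (shape_state d L c f) (shape_state d L c g)"
      using shape_state_in_states[OF d g(2)] ones_shape_state[OF d] f g(2)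
      by (auto simp: step_exclusion_edge_iff_hop[OF _ _ N] \<sigma>_def)
  next
    fix i i' g g'
    assume i: "i \<in> {1..int d}" "i' \<in> {1..int d}"
      and g: "g = bump d i \<sigma> f" "g' = bump d i' \<sigma> f"
        "g \<in> cyl_shapes d L" "g' \<in> cyl_shapes d L"
      and eq: "shape_state d L c g = shape_state d L c g'"
    \<comment> \<open>If the rows differ, the bead \<open>i\<close> of \<open>f\<close> is still in place in \<open>g'\<close>, but its place is empty in \<open>g\<close>.\<close>
    show "i = i'"
    proof (rule ccontr)
      assume "i \<noteq> i'"
      then have "bead c g' i = bead c f i"
        using dvd_diff_window[OF i(2,1)] by (simp add: g(2) bead_bump)
      then have "bead c f i \<in> range (bead c g')" by (metis rangeI)
      also have "range (bead c g') = range (bead c g)"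
        using eq ones_shape_state[OF d g(3), of c] ones_shape_state[OF d g(4), of c] by simp
      finally show False
        using nd by (simp add: g(1) range_bead_bump[OF f])
    qed
  next
    fix v assume v: "v \<in> states d L" "step exclusion_edge s (shape_state d L c f) v"
    then obtain m where h: "hop (d + L) \<sigma> (range (bead c f)) (ones v) m"
      using step_exclusion_edge_iff_hop[OF length_shape_state _ N, of v s c f]
      by (auto simp: ones_shape_state[OF d f] states_def \<sigma>_def)
    then obtain j where j: "m = bead c f j" by (auto simp: hop_def)
    obtain i k where i: "i \<in> {1..int d}" "j = i + k * int d"
      using obtain_window_row[OF d] by metis
    \<comment> \<open>The move may be named by any translate of the particle, so it may be assumed to be the bead of
      a row in \<open>{1..d}\<close>.\<close>
    have m: "m = bead c f i + k * int (d + L)"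
      unfolding j i(2) by (rule bead_periodic[OF f])
    have cls: "int (d + L) dvd x - (m - e) \<longleftrightarrow> int (d + L) dvd x - (bead c f i - e)" for x e
    proof -
      have "x - (bead c f i - e) = x - (m - e) + k * int (d + L)" by (simp add: m)
      then show ?thesis by (simp only: dvd_add_times_triv_right_iff)
    qed
    have "bead c f i - \<sigma> \<notin> range (bead c f)"
    proof -
      have "int (d + L) dvd (m - \<sigma>) - (bead c f i - \<sigma>)" by (simp add: m)
      from range_bead_cong[OF f this, of c] h show ?thesis by (simp add: hop_def)
    qed
    then have g: "bump d i \<sigma> f \<in> cyl_shapes d L"
      using bump_in_cyl_shapes_of_gap[OF f] sign_val_cases by (simp add: \<sigma>_def)
    have "ones v = range (bead c (bump d i \<sigma> f))"
      using h cls[of _ \<sigma>] cls[of _ 0] unfolding range_bead_bump[OF f] hop_def by simp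
    then have "shape_state d L c (bump d i \<sigma> f) = v"
      using v(1) ones_shape_state[OF d g] by (intro ones_inject) (simp_all add: states_def)
    with g i(1) show "\<exists>i\<in>{1..int d}. bump d i \<sigma> f \<in> cyl_shapes d L \<and>
        shape_state d L c (bump d i \<sigma> f) = v" by blast
  qed
qed

lemma length_simplex_state: "length (simplex_state x) = length x + sum_list x"
  by (induction x) (auto simp: simplex_state_def)

text \<open>The \<open>k\<close>-th one, counted from 0, is preceded by \<open>k\<close> ones and by the first \<open>k + 1\<close> blocks of zeros.\<close>

lemma simplex_state_nth:
  "p < length x + sum_list x \<Longrightarrow>
    simplex_state x ! p \<longleftrightarrow> (\<exists>k<length x. p = k + sum_list (take (Suc k) x))"
proof (induction x arbitrary: p)
  case (Cons a x)
  have eq: "simplex_state (a # x) = replicate a False @ True # simplex_state x"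
    by (simp add: simplex_state_def)
  have ex: "(\<exists>k<length (a # x). p = k + sum_list (take (Suc k) (a # x))) \<longleftrightarrow>
      p = a \<or> (\<exists>k<length x. p = Suc k + a + sum_list (take (Suc k) x))"
    by (auto simp: Ex_less_Suc2)
  show ?case
  proof (cases "p \<le> a")
    case True
    then show ?thesis unfolding ex eq by (auto simp: nth_append)
  next
    case False
    define q where "q = p - Suc a"
    have p: "p = Suc a + q" using False by (simp add: q_def)
    have "simplex_state (a # x) ! p \<longleftrightarrow> simplex_state x ! q"
      by (simp add: eq p nth_append)
    also have "\<dots> \<longleftrightarrow> (\<exists>k<length x. q = k + sum_list (take (Suc k) x))"
      using Cons p by simp
    finally show ?thesis unfolding ex by (simp add: p algebra_simps)
  qed
qed simp

text \<open>
  With \<open>c = f 0\<close> the beads 0 and \<open>d\<close> sit at 0 and \<open>d + L\<close>, so that the window contains exactly the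
  beads \<open>1, \<dots>, d\<close>; the partial sums of the differences telescope to \<open>f 0 - f k\<close>, which puts the ones of
  the string at these beads.
\<close>

lemma shape_state_eq_simplex_state:
  assumes d: "d \<ge> 1" and f: "f \<in> cyl_shapes d L"
  shows "shape_state d L (f 0) f = simplex_state (shape_diffs d f)"
proof (rule nth_equalityI)
  have L: "sum_list (shape_diffs d f) = L"
    using shape_diffs_in_simplex[OF f] by (simp add: simplex_def)
  show "length (shape_state d L (f 0) f) = length (simplex_state (shape_diffs d f))"
    by (simp add: length_simplex_state L)
  fix p assume "p < length (shape_state d L (f 0) f)"
  then have p: "p < d + L" by simp
  have bead0: "bead (f 0) f 0 = 0" by (simp add: bead_def)
  have bead_d: "bead (f 0) f (int d) = int (d + L)"
    using bead_periodic[OF f, of "f 0" 0 1] by (simp add: bead0)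
  have row: "int p + 1 = bead (f 0) f (int k + 1) \<longleftrightarrow>
      p = k + sum_list (take (Suc k) (shape_diffs d f))" if "k < d" for k
    using sum_take_shape_diffs[OF f, of "Suc k"] that
    by (simp add: bead_def add.commute) linarith
  have "shape_state d L (f 0) f ! p \<longleftrightarrow> (\<exists>i. int p + 1 = bead (f 0) f i)"
    using shape_state_nth[OF p] by auto
  also have "\<dots> \<longleftrightarrow> (\<exists>k<d. int p + 1 = bead (f 0) f (int k + 1))"
  proof
    assume "\<exists>i. int p + 1 = bead (f 0) f i"
    then obtain i where i: "int p + 1 = bead (f 0) f i" by blast
    have "bead (f 0) f 0 < bead (f 0) f i" using i bead0 by simp
    then have "0 < i" by (simp add: bead_less_iff[OF f])
    moreover have "\<not> bead (f 0) f (int d) < bead (f 0) f i" using i bead_d p by simp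
    then have "i \<le> int d" by (simp add: bead_less_iff[OF f])
    ultimately show "\<exists>k<d. int p + 1 = bead (f 0) f (int k + 1)"
      using i by (intro exI[of _ "nat (i - 1)"]) auto
  qed blast
  also have "\<dots> \<longleftrightarrow> simplex_state (shape_diffs d f) ! p"
    using row p by (auto simp: simplex_state_nth L)
  finally show "shape_state d L (f 0) f ! p = simplex_state (shape_diffs d f) ! p" .
qed


section \<open>The three correspondences\<close>

theorem theorem3p12:
  fixes d L n :: nat and \<alpha> :: "int \<Rightarrow> int" and x :: "nat list" and u :: "bool list"
    and w :: "sign list"
  assumes "d \<ge> 1" and "L \<ge> 1"
    and "\<alpha> \<in> cyl_shapes d L"
    and "x = shape_diffs d \<alpha>"
    and "u = simplex_state x"
    and "length w = n"
  shows "bij_betw (map (shape_diffs d)) (oct d L w \<alpha>) (simplex_walks d L w x) \<and>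
    bij_betw (map (shape_state d L (\<alpha> 0))) (oct d L w \<alpha>) (exclusion_walks d L w u) \<and>
    (\<exists>h. bij_betw h (exclusion_walks d L w u) (necklace_walks d L w (necklace u)) \<and>
         (\<forall>us \<in> exclusion_walks d L w u. fst (h us) = map necklace us))"
proof (intro conjI)
  have u: "u = shape_state d L (\<alpha> 0) \<alpha>"
    using assms shape_state_eq_simplex_state by simp
  show "bij_betw (map (shape_diffs d)) (oct d L w \<alpha>) (simplex_walks d L w x)"
    unfolding oct_def simplex_walks_def \<open>x = shape_diffs d \<alpha>\<close>
    using assms(1,3) by (intro osc_walks_cover shape_diffs_local_bij shape_diffs_in_simplex)
  show "bij_betw (map (shape_state d L (\<alpha> 0))) (oct d L w \<alpha>) (exclusion_walks d L w u)"
    unfolding oct_def exclusion_walks_def u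
    using assms(1-3) by (intro osc_walks_cover shape_state_local_bij shape_state_in_states)
  show "\<exists>h. bij_betw h (exclusion_walks d L w u) (necklace_walks d L w (necklace u)) \<and>
      (\<forall>us \<in> exclusion_walks d L w u. fst (h us) = map necklace us)"
    unfolding u using assms(1,3) by (intro exclusion_walks_bij_necklace_walks shape_state_in_states)
qed

end
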